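(* Let $\mathcal F$ be a marked set over a weakly noetherian reduction structure $\mathcal J=(M,\lambda,\tau)$ and let $g\in\mathcal P$. (i) There exists a reduced form $l$ of $g$ obtained via $\mathcal F$ (that is, $g\rightarrow^+_{\mathcal F\mathcal J} l\downarrow$), and $g-l$ has a representation by $\tau\mathcal F$. (ii) If $\mathcal J$ has disjoint cones, then there is only one polynomial $l$ with $\operatorname{Supp}(l)\subset \mathsf N(J)$ and $g-l\in\langle\tau\mathcal F\rangle$; moreover, there is a unique representation of $g-l$ by $\tau\mathcal F$. (iii) Suppose $\mathcal J$ is noetherian, with well-founded order $\prec$. If, for a polynomial $l$ with $\operatorname{Supp}(l)\subset\mathsf N(J)$, $g-l$ has a representation $\sum_{i=1}^r c_i x^{\gamma_i}f_{\alpha_i}$ by $\tau\mathcal F$ with all distinct heads $x^{\gamma_i+\alpha_i}$, then $g\rightarrow^+_{\mathcal F\mathcal J} l\downarrow$ and, for each $i$, $x^{\gamma_i+\alpha_i}\preceq x^\delta$ for some $x^\delta\in\operatorname{Supp}(g)$. Vice versa, if $g\rightarrow^+_{\mathcal F\mathcal J} l\downarrow$, then $g-l$ has a representation $\sum_{i=1}^r c_i x^{\gamma_i}f_{\alpha_i}$ by $\tau\mathcal F$ with all distinct heads such that for each $i$ one has $x^{\gamma_i+\alpha_i}\preceq x^\delta$ for some $x^\delta\in\operatorname{Supp}(g)$. (iv) In the same hypotheses and setting as (iii), if $g$ is a term $x^\delta$, then $x^\delta-l$ has an $x^\delta$-lower representation by $\tau\mathcal F$.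
   Context: Let $A$ be a field, $\mathcal P=A[x_1,\dots,x_n]$, and $\mathcal T$ the set of terms $x^\alpha=x_1^{\alpha_1}\cdots x_n^{\alpha_n}$, $\alpha\in\mathbb N^n$. $\operatorname{Supp}(g)\subset\mathcal T$ is the set of terms with nonzero coefficient in $g$; $\langle V\rangle$ is the $A$-span of $V\subset\mathcal P$. A semigroup ideal is a subset of $\mathcal T$ closed under multiplication by terms; an order ideal is the complement in $\mathcal T$ of a semigroup ideal. A reduction structure (RS) is a triple $\mathcal J=(M,\lambda=\{\lambda_\alpha\}_{x^\alpha\in M},\tau=\{\tau_\alpha\}_{x^\alpha\in M})$ where $M\subset\mathcal T$ is finite, $J$ denotes the semigroup ideal generated by $M$, each $\tau_\alpha\subseteq\mathcal T$ is an order ideal, $\operatorname{cone}(x^\alpha)=\{x^{\alpha+\eta}: x^\eta\in\tau_\alpha\}$, $\bigcup_{x^\alpha\in M}\operatorname{cone}(x^\alpha)=J$, and $\lambda_\alpha\subseteq\mathcal T\setminus\operatorname{cone}(x^\alpha)$. $\mathsf N(J)=\mathcal T\setminus J$. All RSs are assumed to have finite tails: every $\lambda_\alpha$ is finite. $\mathcal J$ has disjoint cones if $\operatorname{cone}(x^\alpha)\cap\operatorname{cone}(x^{\alpha'})=\emptyset$ for distinct $x^\alpha,x^{\alpha'}\in M$. A substructure of $\mathcal J$ is an RS $(M,\lambda,\tau')$ with $\tau'_\alpha\subseteq\tau_\alpha$ for all $x^\alpha\in M$. A marked set over $\mathcal J$ is a set $\mathcal F=\{f_\alpha\}_{x^\alpha\in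 M}\subset\mathcal P$ such that $x^\alpha$ has coefficient $1$ in $f_\alpha$ and $\operatorname{Supp}(f_\alpha-x^\alpha)\subset\lambda_\alpha$. Put $\tau\mathcal F=\{x^\eta f_\alpha: x^\alpha\in M,\ x^\eta\in\tau_\alpha\}$; the head of $x^\eta f_\alpha$ is $x^{\eta+\alpha}$. One-step reduction: $g\rightarrow_{\mathcal F\mathcal J}h$ if there are $x^\gamma\in\operatorname{Supp}(g)$ with coefficient $c$ in $g$, $x^\alpha\in M$ and $x^\eta\in\tau_\alpha$ with $x^\gamma=x^{\alpha+\eta}$ and $h=g-cx^\eta f_\alpha$. $\rightarrow^+_{\mathcal F\mathcal J}$ is the reflexive-transitive closure. $g\rightarrow^+_{\mathcal F\mathcal J}l\downarrow$ means $g\rightarrow^+_{\mathcal F\mathcal J}l$ and $\operatorname{Supp}(l)\subset\mathsf N(J)$; then $l$ is a reduced form of $g$. $\mathcal J$ is noetherian if for every marked set $\mathcal F$ over $\mathcal J$ there is no infinite chain of one-step reductions; it is weakly noetherian if it has a noetherian substructure. $\mathcal J$ is ordered by a well-founded order $\prec$ on $\mathcal T$ (a strict partial order for which every nonempty subset has minimal elements) if $x^{\gamma+\eta}\prec x^{\alpha+\eta}$ for all $x^\alpha\in M$, $x^\gamma\in\lambda_\alpha$, $x^\eta\in\tau_\alpha$. Noetherian and ordered are treated as synonyms, and a noetherian $\mathcal J$ comes with a fixed such order $\prec$. A representation of $g$ by $\tau\mathcal F$ is an expression $g=\sum_{i=1}^r c_i x^{\eta_i}f_{\alpha_i}$ with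 $c_i\in A$ and $x^{\eta_i}f_{\alpha_i}$ distinct elements of $\tau\mathcal F$. It is an $x^\delta$-lower representation if $x^{\eta_i+\alpha_i}\preceq x^\delta$ for every $i$.
   Formalization: The "vice versa" of (iii) fails for overlapping cones; here every reduced form gets a representation with bounded heads, and distinct heads are claimed only for reductions using a subset of τF (as pairs) with pairwise distinct heads (automatic for disjoint cones). *)

theory Defs
  imports Complex_Main "HOL-Library.Poly_Mapping"
begin

section \<open>Terms and polynomials\<close>

text \<open>
  The finite type \<open>'n\<close> indexes the variables. A term \<open>x^\<alpha>\<close> is identified with its exponent
  vector \<open>\<alpha>\<close>, so the product of terms is written additively. The product of polynomial mappings
  is convolution.
\<close>

type_synonym 'n pp = "'n \<Rightarrow>\<^sub>0 nat"
type_synonym ('n, 'a) mpoly = "'n pp \<Rightarrow>\<^sub>0 'a"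

text \<open>\<open>monomial c \<eta>\<close> is \<open>c x^\<eta>\<close>; in particular, \<open>monomial c 0\<close> is the constant \<open>c\<close>.\<close>

abbreviation monomial :: "'a \<Rightarrow> 'n pp \<Rightarrow> ('n, 'a::zero) mpoly" where
  "monomial c \<eta> \<equiv> Poly_Mapping.single \<eta> c"

abbreviation supp :: "('b \<Rightarrow>\<^sub>0 'a::zero) \<Rightarrow> 'b set" where
  "supp \<equiv> Poly_Mapping.keys"

abbreviation coeff :: "('b \<Rightarrow>\<^sub>0 'a::zero) \<Rightarrow> 'b \<Rightarrow> 'a" where
  "coeff \<equiv> Poly_Mapping.lookup"

interpretation poly_space: vector_space
  "\<lambda>(c::'a::field) (p::('n, 'a) mpoly). monomial c 0 * p"
  by unfold_locales (simp_all add: algebra_simps single_add mult_single)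

definition semigroup_ideal :: "'n pp set \<Rightarrow> bool" where
  "semigroup_ideal S \<longleftrightarrow> (\<forall>\<sigma>\<in>S. \<forall>\<eta>. \<sigma> + \<eta> \<in> S)"

definition order_ideal :: "'n pp set \<Rightarrow> bool" where
  "order_ideal S \<longleftrightarrow> semigroup_ideal (- S)"

section \<open>Reduction structures\<close>

text \<open>
  The components are \<open>M\<close>, \<open>\<lambda>\<close> and \<open>\<tau>\<close>; the values of the two families outside \<open>M\<close> are irrelevant.
\<close>

record 'n red_struct =
  hterms :: "'n pp set"
  tails :: "'n pp \<Rightarrow> 'n pp set"
  mults :: "'n pp \<Rightarrow> 'n pp set"

definition cone :: "'n red_struct \<Rightarrow> 'n pp \<Rightarrow> 'n pp set" where
  "cone J \<alpha> = {\<alpha> + \<eta> | \<eta>. \<eta> \<in> mults J \<alpha>}"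

definition gen_ideal :: "'n red_struct \<Rightarrow> 'n pp set" where
  "gen_ideal J = semigroup_ideal hull hterms J"

definition nonideal_terms :: "'n red_struct \<Rightarrow> 'n pp set" where
  "nonideal_terms J = - gen_ideal J"

text \<open>Finiteness of the tails is part of the definition.\<close>

definition red_structure :: "'n red_struct \<Rightarrow> bool" where
  "red_structure J \<longleftrightarrow>
     finite (hterms J) \<and>
     (\<forall>\<alpha>\<in>hterms J. order_ideal (mults J \<alpha>)) \<and>
     (\<Union>\<alpha>\<in>hterms J. cone J \<alpha>) = gen_ideal J \<and>
     (\<forall>\<alpha>\<in>hterms J. tails J \<alpha> \<subseteq> - cone J \<alpha> \<and> finite (tails J \<alpha>))"

definition disjoint_cones :: "'n red_struct \<Rightarrow> bool" where
  "disjoint_cones J \<longleftrightarrow>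
     (\<forall>\<alpha>\<in>hterms J. \<forall>\<alpha>'\<in>hterms J. \<alpha> \<noteq> \<alpha>' \<longrightarrow> cone J \<alpha> \<inter> cone J \<alpha>' = {})"

definition substructure :: "'n red_struct \<Rightarrow> 'n red_struct \<Rightarrow> bool" where
  "substructure J' J \<longleftrightarrow>
     red_structure J' \<and> hterms J' = hterms J \<and>
     (\<forall>\<alpha>\<in>hterms J. tails J' \<alpha> = tails J \<alpha> \<and> mults J' \<alpha> \<subseteq> mults J \<alpha>)"

section \<open>Marked sets and reduction\<close>

definition marked_set :: "'n red_struct \<Rightarrow> ('n pp \<Rightarrow> ('n, 'a::field) mpoly) \<Rightarrow> bool" where
  "marked_set J F \<longleftrightarrow>
     (\<forall>\<alpha>\<in>hterms J. coeff (F \<alpha>) \<alpha> = 1 \<and> supp (F \<alpha> - monomial 1 \<alpha>) \<subseteq> tails J \<alpha>)"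

text \<open>
  The pair \<open>(\<alpha>, \<eta>)\<close> stands for \<open>x^\<eta> f_\<alpha>\<close>. The head is an attribute of this pair rather than of
  the underlying polynomial, hence pairs are kept as indices.
\<close>

definition index_pairs :: "'n red_struct \<Rightarrow> ('n pp \<times> 'n pp) set" where
  "index_pairs J = (SIGMA \<alpha>:hterms J. mults J \<alpha>)"

definition elt :: "('n pp \<Rightarrow> ('n, 'a::field) mpoly) \<Rightarrow> 'n pp \<times> 'n pp \<Rightarrow> ('n, 'a) mpoly" where
  "elt F = (\<lambda>(\<alpha>, \<eta>). monomial 1 \<eta> * F \<alpha>)"

definition head :: "'n pp \<times> 'n pp \<Rightarrow> 'n pp" where
  "head = (\<lambda>(\<alpha>, \<eta>). \<eta> + \<alpha>)"

definition tau_set :: "'n red_struct \<Rightarrow> ('n pp \<Rightarrow> ('n, 'a::field) mpoly) \<Rightarrow> ('n, 'a) mpoly set" where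
  "tau_set J F = elt F ` index_pairs J"

text \<open>
  Reduction with \<open>\<tau>F\<close> restricted to a set \<open>S\<close> of pairs; the full reduction is the case
  \<open>S = index_pairs J\<close>. Where cones overlap, a chain of full reductions can reduce the same term
  twice by different elements, and then its result need not be described by a representation with
  distinct heads, even if \<open>J\<close> is noetherian. For instance, in one variable, let
  \<open>M = {x^2, x^3, x^4}\<close> with multipliers \<open>{1, x}\<close>, \<open>{1}\<close>, and all terms, and
  \<open>f\<^sub>2 = x^2 - 1\<close>, \<open>f\<^sub>3 = x^3 - 1\<close>, \<open>f\<^sub>4 = x^4 - x^3\<close>. Then
  \<open>x^4 + x^3 \<rightarrow> x^4 + x \<rightarrow> x^3 + x \<rightarrow> x + 1\<close> by \<open>x f\<^sub>2\<close>, \<open>f\<^sub>4\<close>, \<open>f\<^sub>3\<close>, and the only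
  representation of the difference uses both \<open>x f\<^sub>2\<close> and \<open>f\<^sub>3\<close>, which have the same head.
  A chain reduces every term in only one way if it stays within a set \<open>S\<close> on which \<open>head\<close> is
  injective; with disjoint cones, \<open>index_pairs J\<close> itself is such a set.
\<close>

definition red_step_by ::
  "('n pp \<Rightarrow> ('n, 'a::field) mpoly) \<Rightarrow> ('n pp \<times> 'n pp) set \<Rightarrow>
   ('n, 'a) mpoly \<Rightarrow> ('n, 'a) mpoly \<Rightarrow> bool" where
  "red_step_by F S g h \<longleftrightarrow>
     (\<exists>(\<alpha>, \<eta>)\<in>S. \<exists>\<gamma>\<in>supp g. \<gamma> = \<alpha> + \<eta> \<and> h = g - monomial (coeff g \<gamma>) \<eta> * F \<alpha>)"

abbreviation red_step ::
  "'n red_struct \<Rightarrow> ('n pp \<Rightarrow> ('n, 'a::field) mpoly) \<Rightarrow>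
   ('n, 'a) mpoly \<Rightarrow> ('n, 'a) mpoly \<Rightarrow> bool" where
  "red_step J F \<equiv> red_step_by F (index_pairs J)"

definition reduced_form ::
  "'n red_struct \<Rightarrow> ('n pp \<Rightarrow> ('n, 'a::field) mpoly) \<Rightarrow>
   ('n, 'a) mpoly \<Rightarrow> ('n, 'a) mpoly \<Rightarrow> bool" where
  "reduced_form J F g l \<longleftrightarrow> (red_step J F)\<^sup>*\<^sup>* g l \<and> supp l \<subseteq> nonideal_terms J"

text \<open>The type argument fixes the coefficient field of the marked sets.\<close>

definition noetherian :: "'a::field itself \<Rightarrow> 'n red_struct \<Rightarrow> bool" where
  "noetherian _ J \<longleftrightarrow>
     (\<forall>F :: 'n pp \<Rightarrow> ('n, 'a) mpoly. marked_set J F \<longrightarrow>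
        \<not> (\<exists>G :: nat \<Rightarrow> ('n, 'a) mpoly. \<forall>i. red_step J F (G i) (G (Suc i))))"

definition weakly_noetherian :: "'a::field itself \<Rightarrow> 'n red_struct \<Rightarrow> bool" where
  "weakly_noetherian K J \<longleftrightarrow> (\<exists>J'. substructure J' J \<and> noetherian K J')"

definition well_founded_order :: "('n pp \<Rightarrow> 'n pp \<Rightarrow> bool) \<Rightarrow> bool" where
  "well_founded_order prec \<longleftrightarrow>
     irreflp prec \<and> transp prec \<and>
     (\<forall>S. S \<noteq> {} \<longrightarrow> (\<exists>\<mu>\<in>S. \<forall>\<sigma>\<in>S. \<not> prec \<sigma> \<mu>))"

definition ordered_by :: "('n pp \<Rightarrow> 'n pp \<Rightarrow> bool) \<Rightarrow> 'n red_struct \<Rightarrow> bool" where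
  "ordered_by prec J \<longleftrightarrow>
     well_founded_order prec \<and>
     (\<forall>\<alpha>\<in>hterms J. \<forall>\<gamma>\<in>tails J \<alpha>. \<forall>\<eta>\<in>mults J \<alpha>. prec (\<gamma> + \<eta>) (\<alpha> + \<eta>))"

section \<open>Representations\<close>

text \<open>
  A representation is a finitely supported family \<open>c\<close> of coefficients on index pairs. Its summands
  are those with nonzero coefficient, and their order is immaterial, as is understood when
  representations are said to be unique or their heads to be bounded.
\<close>

definition tau_representation ::
  "'n red_struct \<Rightarrow> ('n pp \<Rightarrow> ('n, 'a::field) mpoly) \<Rightarrow>
   ('n pp \<times> 'n pp \<Rightarrow>\<^sub>0 'a) \<Rightarrow> ('n, 'a) mpoly \<Rightarrow> bool" where
  "tau_representation J F c g \<longleftrightarrow>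
     supp c \<subseteq> index_pairs J \<and> inj_on (elt F) (supp c) \<and>
     g = (\<Sum>p\<in>supp c. monomial (coeff c p) 0 * elt F p)"

definition distinct_heads :: "('n pp \<times> 'n pp \<Rightarrow>\<^sub>0 'a::zero) \<Rightarrow> bool" where
  "distinct_heads c \<longleftrightarrow> inj_on head (supp c)"

definition heads_bounded ::
  "('n pp \<Rightarrow> 'n pp \<Rightarrow> bool) \<Rightarrow> ('n pp \<times> 'n pp \<Rightarrow>\<^sub>0 'a::zero) \<Rightarrow> ('n, 'b::zero) mpoly \<Rightarrow> bool" where
  "heads_bounded prec c g \<longleftrightarrow> (\<forall>p\<in>supp c. \<exists>\<delta>\<in>supp g. prec\<^sup>=\<^sup>= (head p) \<delta>)"

definition lower_representation ::
  "('n pp \<Rightarrow> 'n pp \<Rightarrow> bool) \<Rightarrow> 'n pp \<Rightarrow> 'n red_struct \<Rightarrow> ('n pp \<Rightarrow> ('n, 'a::field) mpoly) \<Rightarrow>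
   ('n pp \<times> 'n pp \<Rightarrow>\<^sub>0 'a) \<Rightarrow> ('n, 'a) mpoly \<Rightarrow> bool" where
  "lower_representation prec \<delta> J F c g \<longleftrightarrow>
     tau_representation J F c g \<and> (\<forall>p\<in>supp c. prec\<^sup>=\<^sup>= (head p) \<delta>)"

end

theory Submission
  imports Defs
begin

text \<open>
  Two observations carry the proof. First, a reduction step changes a polynomial by a multiple of an
  element of \<open>\<tau>F\<close>, so a chain from \<open>g\<close> to \<open>l\<close> places \<open>g - l\<close> in the span of the elements that it
  uses (\<open>red_chain_span\<close>), and a span membership can be turned into a representation
  (\<open>representation_of_span\<close>). A chain by the noetherian substructure cannot go on for ever, and it
  stops only outside the ideal because the cones of the substructure still cover the ideal. This
  gives reduced forms.

  Secondly, if finitely many index pairs \<open>P\<close> have distinct heads and reduction by \<open>P\<close> terminates,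
  then no nontrivial combination of the elements of \<open>P\<close> avoids all heads of \<open>P\<close>
  (\<open>combination_avoiding_heads\<close>). This is a dimension count: termination says that modulo these
  elements every head can be rewritten in terms of non-heads, so none of the elements can be
  superfluous. Comparing leading terms would not do here, because uniqueness is claimed from the
  chain condition alone, without a given order. Disjointness of the cones makes all heads distinct
  (\<open>inj_on_head_if_disjoint_cones\<close>) and forces the noetherian substructure to have the same index
  pairs as the structure (\<open>index_pairs_substructure_disjoint_cones\<close>), so both uniqueness claims
  follow.

  If an order \<open>\<prec>\<close> is given, then all terms of an element other than its head lie strictly below the
  head. Hence reduction never leaves the set of terms bounded by those of \<open>g\<close>, which bounds the
  heads used (\<open>red_chain_representation\<close>). Conversely, in a representation of \<open>g - l\<close> with distinct
  heads, a maximal head cannot be cancelled and so occurs in \<open>g\<close> with the coefficient of the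
  representation; one reduction step removes the corresponding summand, and induction yields a
  chain from \<open>g\<close> to \<open>l\<close> (\<open>reduction_along_representation\<close>).
\<close>

section \<open>Reduction chains and spans\<close>

lemma red_step_by_iff:
  fixes F :: "'n pp \<Rightarrow> ('n, 'a::field) mpoly"
  shows "red_step_by F S g h \<longleftrightarrow>
    (\<exists>p\<in>S. head p \<in> supp g \<and> h = g - monomial (coeff g (head p)) 0 * elt F p)"
proof -
  have scale: "monomial c \<eta> * F \<alpha> = monomial c 0 * (monomial 1 \<eta> * F \<alpha>)"
    for c and \<eta> \<alpha> :: "'n pp"
    by (simp add: mult.assoc[symmetric] mult_single)
  show ?thesis
    unfolding red_step_by_def
  proof (intro bex_cong refl, clarify)
    fix \<alpha> \<eta> :: "'n pp"
    show "(\<exists>\<gamma>\<in>supp g. \<gamma> = \<alpha> + \<eta> \<and> h = g - monomial (coeff g \<gamma>) \<eta> * F \<alpha>)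
      \<longleftrightarrow> head (\<alpha>, \<eta>) \<in> supp g
        \<and> h = g - monomial (coeff g (head (\<alpha>, \<eta>))) 0 * elt F (\<alpha>, \<eta>)"
      unfolding head_def elt_def prod.case scale[of \<eta> _ \<alpha>, symmetric] add.commute[of \<eta> \<alpha>]
      by blast
  qed
qed

lemma red_chain_mono:
  assumes "(red_step_by F S)\<^sup>*\<^sup>* g h" and "S \<subseteq> T"
  shows "(red_step_by F T)\<^sup>*\<^sup>* g h"
proof -
  have "red_step_by F S \<le> red_step_by F T"
    using assms(2) by (auto simp: red_step_by_def le_fun_def)
  then show ?thesis using assms(1) rtranclp_mono by blast
qed

lemma supp_scale_subset: "supp (monomial c 0 * p) \<subseteq> supp p"
  for p :: "('n, 'a::field) mpoly"
  using keys_mult[of "monomial c 0" p] by (auto split: if_splits)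

text \<open>
  The set \<open>D\<close> is one that reduction by \<open>S\<close> never leaves. For \<open>D = UNIV\<close> only the span
  membership is of interest; with the terms bounded by those of \<open>g\<close> the heads become bounded.
\<close>
lemma red_chain_span:
  assumes "(red_step_by F S)\<^sup>*\<^sup>* g h"
    and "supp g \<subseteq> D"
    and "\<And>p. p \<in> S \<Longrightarrow> head p \<in> D \<Longrightarrow> supp (elt F p) \<subseteq> D"
  shows "supp h \<subseteq> D \<and> g - h \<in> poly_space.span (elt F ` {p \<in> S. head p \<in> D})"
  using assms(1)
proof induction
  case base
  then show ?case using assms(2) by (simp add: poly_space.span_zero)
next
  case (step y z)
  from step(2) obtain p where p: "p \<in> S" "head p \<in> supp y"
    and z: "z = y - monomial (coeff y (head p)) 0 * elt F p"
    by (auto simp: red_step_by_iff)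
  have hD: "head p \<in> D" using p step.IH by auto
  have "supp z \<subseteq> supp y \<union> supp (elt F p)"
    using keys_diff[of y "monomial (coeff y (head p)) 0 * elt F p"]
      supp_scale_subset[of "coeff y (head p)" "elt F p"] unfolding z by blast
  then have 1: "supp z \<subseteq> D" using step.IH assms(3)[OF p(1) hD] by blast
  have "g - z = (g - y) + monomial (coeff y (head p)) 0 * elt F p"
    unfolding z by simp
  also have "\<dots> \<in> poly_space.span (elt F ` {p \<in> S. head p \<in> D})"
    using step.IH p(1) hD
    by (intro poly_space.span_add[OF _ poly_space.span_scale[OF poly_space.span_base]]) auto
  finally show ?case using 1 by blast
qed

lemma terminating_reduction_avoids_heads:
  assumes "\<nexists>G :: nat \<Rightarrow> ('n, 'a::field) mpoly. \<forall>i. red_step_by F S (G i) (G (Suc i))"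
  obtains h where "(red_step_by F S)\<^sup>*\<^sup>* g h" and "supp h \<inter> head ` S = {}"
proof -
  have "wfP (red_step_by F S)\<inverse>\<inverse>"
    using assms by (auto simp: wfp_def wf_iff_no_infinite_down_chain)
  then have "\<exists>h. (red_step_by F S)\<^sup>*\<^sup>* g h \<and> supp h \<inter> head ` S = {}"
  proof (induction g rule: wfp_induct_rule)
    case (less g)
    show ?case
    proof (cases "supp g \<inter> head ` S = {}")
      case False
      then obtain g' where g': "red_step_by F S g g'" by (auto simp: red_step_by_iff)
      then obtain h where "(red_step_by F S)\<^sup>*\<^sup>* g' h" "supp h \<inter> head ` S = {}"
        using less by auto
      with g' show ?thesis by (meson converse_rtranclp_into_rtranclp)
    qed blast
  qed
  then show thesis using that by blast
qed

section \<open>Representations\<close>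

text \<open>
  Distinct index pairs can denote the same polynomial, so one index pair is chosen for each
  polynomial that occurs; the choice is made within \<open>P\<close> to let representations inherit any property
  of the heads in \<open>P\<close>.
\<close>
lemma representation_of_span:
  assumes "h \<in> poly_space.span (elt F ` P)" and "P \<subseteq> index_pairs J"
  obtains c where "tau_representation J F c h" and "supp c \<subseteq> P"
proof -
  from assms(1) obtain t r where t: "finite t" "t \<subseteq> elt F ` P"
    and h: "h = (\<Sum>a\<in>t. monomial (r a) 0 * a)"
    unfolding poly_space.span_explicit mem_Collect_eq by (elim exE conjE)
  define i where "i = inv_into P (elt F)"
  have iP: "i a \<in> P" and ei: "elt F (i a) = a" if "a \<in> t" for a
    using t(2) that by (auto simp: i_def inv_into_into f_inv_into_f subset_iff)
  define c where "c = Abs_poly_mapping (\<lambda>p. if p \<in> i ` t then r (elt F p) else 0)"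
  have lc: "coeff c p = (if p \<in> i ` t then r (elt F p) else 0)" for p
    unfolding c_def by (subst lookup_Abs_poly_mapping) (use t(1) in auto)
  have sc: "supp c \<subseteq> i ` t" by (auto simp: in_keys_iff lc split: if_splits)
  have scP: "supp c \<subseteq> P" using sc iP by blast
  have inj: "inj_on (elt F) (i ` t)" by (intro inj_onI) (elim imageE, simp add: ei)
  have inji: "inj_on i t" by (metis ei inj_onI)
  have "(\<Sum>p\<in>supp c. monomial (coeff c p) 0 * elt F p)
      = (\<Sum>p\<in>i ` t. monomial (coeff c p) 0 * elt F p)"
    using sc t(1) by (intro sum.mono_neutral_left) (auto simp: in_keys_iff)
  also have "\<dots> = h"
    unfolding h by (subst sum.reindex[OF inji]) (auto intro!: sum.cong simp: lc ei)
  finally have "tau_representation J F c h"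
    unfolding tau_representation_def
    using scP assms(2) inj_on_subset[OF inj sc] by auto
  then show thesis using scP by (rule that)
qed

section \<open>Independence modulo non-heads\<close>

lemma sum_monomials: "(\<Sum>u\<in>supp h. monomial (coeff h u) 0 * monomial 1 u) = h"
  for h :: "('n, 'a::field) mpoly"
  by (rule poly_mapping_eqI)
     (auto simp: lookup_sum mult_single lookup_single when_def in_keys_iff)

lemma span_monomials: "poly_space.span (monomial 1 ` U) = {h :: ('n, 'a::field) mpoly. supp h \<subseteq> U}"
proof (intro set_eqI iffI)
  fix h :: "('n, 'a) mpoly"
  assume "h \<in> poly_space.span (monomial 1 ` U)"
  then have "supp h \<subseteq> U"
  proof (induction rule: poly_space.span_induct_alt)
    case (step c x y)
    then show ?case
      using keys_add[of "monomial c 0 * x" y] supp_scale_subset[of c x] by fastforce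
  qed simp
  then show "h \<in> {h. supp h \<subseteq> U}" by simp
next
  fix h :: "('n, 'a) mpoly"
  assume "h \<in> {h. supp h \<subseteq> U}"
  then have "(\<Sum>u\<in>supp h. monomial (coeff h u) 0 * monomial 1 u)
      \<in> poly_space.span (monomial 1 ` U)"
    by (intro poly_space.span_sum poly_space.span_scale poly_space.span_base) auto
  then show "h \<in> poly_space.span (monomial 1 ` U)" by (simp only: sum_monomials)
qed

lemma inj_on_monomial: "inj_on (\<lambda>u. monomial (1::'a::field) u) U"
  by (metis (mono_tags, lifting) inj_onI keys_single singleton_inject zero_neq_one)

lemma independent_monomials:
  "poly_space.independent ((\<lambda>u. monomial (1::'a::field) u) ` U)"
  unfolding poly_space.dependent_def
proof clarify
  fix u
  assume u: "u \<in> U"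
    and d: "monomial (1::'a) u \<in> poly_space.span (monomial 1 ` U - {monomial 1 u})"
  have "monomial (1::'a) ` U - {monomial 1 u} \<subseteq> monomial 1 ` (U - {u})" by auto
  with d have "monomial (1::'a) u \<in> poly_space.span (monomial 1 ` (U - {u}))"
    using poly_space.span_mono by blast
  then show False by (simp add: span_monomials)
qed

text \<open>
  Let \<open>U\<close> collect the heads of \<open>P\<close> and all terms of the elements of \<open>P\<close>. By termination, the
  non-heads in \<open>U\<close> and the elements of \<open>P\<close> together span all \<open>card U\<close> terms in \<open>U\<close>, and there are
  at most \<open>card U\<close> of them. An element occurring in a combination that avoids all heads could be
  dropped from these generators, leaving too few.
\<close>
lemma combination_avoiding_heads:
  fixes F :: "'n pp \<Rightarrow> ('n, 'a::field) mpoly"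
  assumes fin: "finite P" and inj: "inj_on head P"
    and terminates: "\<nexists>G :: nat \<Rightarrow> ('n, 'a) mpoly. \<forall>i. red_step_by F P (G i) (G (Suc i))"
    and avoid: "supp (\<Sum>p\<in>P. monomial (c p) 0 * elt F p) \<inter> head ` P = {}"
    and p: "p \<in> P"
  shows "c p = 0"
proof (rule ccontr)
  assume cp: "c p \<noteq> 0"
  define U where "U = head ` P \<union> (\<Union>p\<in>P. supp (elt F p))"
  define K where "K = U - head ` P"
  define C where "C = monomial 1 ` K \<union> elt F ` (P - {p})"
  let ?sp = "poly_space.span"
  have fU: "finite U" and fK: "finite K" using fin by (auto simp: U_def K_def)
  define h where "h = (\<Sum>p\<in>P. monomial (c p) 0 * elt F p)"
  have "supp h \<subseteq> U"
  proof
    fix u assume "u \<in> supp h"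
    then have "(\<Sum>p\<in>P. coeff (monomial (c p) 0 * elt F p) u) \<noteq> 0"
      by (simp add: in_keys_iff h_def lookup_sum)
    then obtain q where "q \<in> P" "coeff (monomial (c q) 0 * elt F q) u \<noteq> 0"
      by (rule sum.not_neutral_contains_not_neutral)
    then show "u \<in> U"
      using supp_scale_subset[of "c q" "elt F q"] by (auto simp: U_def in_keys_iff)
  qed
  then have "supp h \<subseteq> K" using avoid by (auto simp: K_def h_def)
  then have "h \<in> ?sp (monomial 1 ` K)" by (simp add: span_monomials)
  then have hC: "h \<in> ?sp C"
    using poly_space.span_mono[of "monomial 1 ` K" C] by (auto simp: C_def)
  \<comment> \<open>The combination is solved for \<open>elt F p\<close>, which is therefore superfluous.\<close>
  have "monomial (c p) 0 * elt F p = h - (\<Sum>q\<in>P - {p}. monomial (c q) 0 * elt F q)"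
    using fin p by (simp add: h_def sum.remove)
  also have "\<dots> \<in> ?sp C"
    by (intro poly_space.span_diff[OF hC] poly_space.span_sum poly_space.span_scale
        poly_space.span_base) (auto simp: C_def)
  finally have "monomial (1 / c p) 0 * (monomial (c p) 0 * elt F p) \<in> ?sp C"
    by (rule poly_space.span_scale)
  then have epC: "elt F p \<in> ?sp C"
    using cp by (simp add: mult.assoc[symmetric] mult_single)
  have PC: "elt F ` P \<subseteq> ?sp C"
    using epC poly_space.span_base[of _ C] by (auto simp: C_def)
  have "monomial 1 u \<in> ?sp C" if u: "u \<in> U" for u
  proof -
    obtain k where k: "(red_step_by F P)\<^sup>*\<^sup>* (monomial 1 u) k" and k0: "supp k \<inter> head ` P = {}"
      using terminating_reduction_avoids_heads[OF terminates] by blast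
    have *: "supp k \<subseteq> U \<and> monomial 1 u - k \<in> ?sp (elt F ` {p \<in> P. head p \<in> U})"
      using u by (intro red_chain_span[OF k]) (auto simp: U_def)
    then have "k \<in> ?sp (monomial 1 ` K)" using k0 by (auto simp: span_monomials K_def)
    then have "k \<in> ?sp C" using poly_space.span_mono[of "monomial 1 ` K" C] by (auto simp: C_def)
    moreover have "monomial 1 u - k \<in> ?sp C"
      using * PC poly_space.span_minimal[OF _ poly_space.subspace_span,
          of "elt F ` {p \<in> P. head p \<in> U}" C] by blast
    ultimately have "(monomial 1 u - k) + k \<in> ?sp C" by (intro poly_space.span_add)
    then show ?thesis by simp
  qed
  then have "card (monomial (1::'a) ` U) \<le> card C"
    using poly_space.independent_span_bound[of C "monomial 1 ` U"] fK fin
      independent_monomials[of U] by (auto simp: C_def)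
  also have "card C \<le> card K + card (P - {p})"
    unfolding C_def by (meson add_mono card_Un_le card_image_le fK fin finite_Diff le_trans)
  also have "\<dots> < card K + card (head ` P)"
    using fin p by (simp add: card_image[OF inj] card_Diff1_less del: card_Diff_insert)
  also have "\<dots> = card U"
    using fK fin card_Un_disjoint[of K "head ` P"]
    by (simp add: K_def U_def Un_commute Diff_partition inf_commute)
  also have "\<dots> = card (monomial (1::'a) ` U)"
    by (simp add: card_image inj_on_monomial)
  finally show False by simp
qed

section \<open>The chain condition and disjoint cones\<close>

lemma heads_index_pairs: "head ` index_pairs J = (\<Union>\<alpha>\<in>hterms J. cone J \<alpha>)"
  by (force simp: head_def index_pairs_def cone_def add.commute image_iff)

lemma heads_eq_gen_ideal: "red_structure J \<Longrightarrow> head ` index_pairs J = gen_ideal J"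
  by (simp add: heads_index_pairs red_structure_def)

lemma gen_ideal_substructure: "substructure J' J \<Longrightarrow> gen_ideal J' = gen_ideal J"
  by (simp add: gen_ideal_def substructure_def)

lemma index_pairs_substructure: "substructure J' J \<Longrightarrow> index_pairs J' \<subseteq> index_pairs J"
  by (auto simp: index_pairs_def substructure_def)

lemma marked_set_substructure: "substructure J' J \<Longrightarrow> marked_set J F \<Longrightarrow> marked_set J' F"
  by (simp add: marked_set_def substructure_def)

lemma inj_on_head_if_disjoint_cones:
  assumes "disjoint_cones J"
  shows "inj_on head (index_pairs J)"
proof (rule inj_onI)
  fix p q assume pq: "p \<in> index_pairs J" "q \<in> index_pairs J" "head p = head q"
  obtain \<alpha> \<eta> \<beta> \<zeta> where [simp]: "p = (\<alpha>, \<eta>)" "q = (\<beta>, \<zeta>)" by (cases p, cases q)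
  have "head p \<in> cone J \<alpha>" "head q \<in> cone J \<beta>"
    using pq(1,2) by (auto simp: head_def index_pairs_def cone_def add.commute)
  then have "head p \<in> cone J \<alpha> \<inter> cone J \<beta>"
    using pq(3) by simp
  then have "\<alpha> = \<beta>" using assms pq by (auto simp: disjoint_cones_def index_pairs_def)
  then show "p = q" using pq by (simp add: head_def)
qed

text \<open>
  The smaller cones of a substructure still have to cover the same ideal, which disjoint cones permit
  only if nothing was removed.
\<close>
lemma index_pairs_substructure_disjoint_cones:
  assumes "red_structure J" and "substructure J' J" and "disjoint_cones J"
  shows "index_pairs J' = index_pairs J"
proof
  show "index_pairs J \<subseteq> index_pairs J'"
  proof
    fix p assume p: "p \<in> index_pairs J"
    have "head ` index_pairs J = head ` index_pairs J'"
      using assms gen_ideal_substructure heads_eq_gen_ideal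
      by (metis substructure_def)
    then obtain q where "q \<in> index_pairs J'" "head p = head q" using p by (metis imageE imageI)
    then show "p \<in> index_pairs J'"
      using p inj_on_head_if_disjoint_cones[OF assms(3)] index_pairs_substructure[OF assms(2)]
      by (metis inj_onD subsetD)
  qed
qed (rule index_pairs_substructure[OF assms(2)])

text \<open>
  The difference of the two representations is a combination that avoids all heads. With \<open>g = h\<close>
  this gives uniqueness of representations. For reduced forms \<open>l\<close> and \<open>l'\<close> of one polynomial \<open>f\<close>,
  the choice of \<open>f - l\<close> and \<open>f - l'\<close> for \<open>g\<close> and \<open>h\<close> gives \<open>l = l'\<close>.
\<close>
lemma representation_unique:
  fixes F :: "'n pp \<Rightarrow> ('n, 'a::field) mpoly"
  assumes inj: "inj_on head (index_pairs J)"
    and terminates: "\<nexists>G :: nat \<Rightarrow> ('n, 'a) mpoly. \<forall>i. red_step J F (G i) (G (Suc i))"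
    and c: "tau_representation J F c g" and d: "tau_representation J F d h"
    and avoid: "supp (g - h) \<inter> head ` index_pairs J = {}"
  shows "c = d"
proof (rule poly_mapping_eqI)
  fix p
  define P where "P = supp c \<union> supp d"
  have PI: "P \<subseteq> index_pairs J" using c d by (auto simp: P_def tau_representation_def)
  have "g = (\<Sum>p\<in>P. monomial (coeff c p) 0 * elt F p)"
    using c unfolding tau_representation_def P_def
    by (auto intro!: sum.mono_neutral_left simp: in_keys_iff)
  moreover have "h = (\<Sum>p\<in>P. monomial (coeff d p) 0 * elt F p)"
    using d unfolding tau_representation_def P_def
    by (auto intro!: sum.mono_neutral_left simp: in_keys_iff)
  ultimately have gh: "g - h = (\<Sum>p\<in>P. monomial (coeff c p - coeff d p) 0 * elt F p)"
    by (simp add: sum_subtractf[symmetric] single_diff left_diff_distrib)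
  have "coeff c p - coeff d p = 0" if "p \<in> P"
  proof (rule combination_avoiding_heads[where c = "\<lambda>p. coeff c p - coeff d p", OF _ _ _ _ that])
    show "\<nexists>G :: nat \<Rightarrow> ('n, 'a) mpoly. \<forall>i. red_step_by F P (G i) (G (Suc i))"
      using terminates PI unfolding red_step_by_iff by (meson subsetD)
    show "supp (\<Sum>p\<in>P. monomial (coeff c p - coeff d p) 0 * elt F p) \<inter> head ` P = {}"
      using avoid PI unfolding gh by blast
  qed (auto simp: P_def intro: inj_on_subset[OF inj PI[unfolded P_def]])
  then show "coeff c p = coeff d p"
    by (cases "p \<in> P") (auto simp: P_def in_keys_iff)
qed

section \<open>Ordered reduction structures\<close>

lemma elt_terms_below_head:
  assumes "marked_set J F" and "ordered_by prec J" and "p \<in> index_pairs J"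
  shows "coeff (elt F p) (head p) = 1"
    and "\<And>\<sigma>. \<sigma> \<in> supp (elt F p) \<Longrightarrow> prec\<^sup>=\<^sup>= \<sigma> (head p)"
proof -
  obtain \<alpha> \<eta> where pe: "p = (\<alpha>, \<eta>)" by (cases p)
  have a: "\<alpha> \<in> hterms J" "\<eta> \<in> mults J \<alpha>" using assms(3) by (auto simp: pe index_pairs_def)
  define t where "t = F \<alpha> - monomial 1 \<alpha>"
  have "supp t \<subseteq> tails J \<alpha>" using assms(1) a by (auto simp: marked_set_def t_def)
  moreover have "supp (monomial 1 \<eta> * t) \<subseteq> {\<eta> + \<gamma> | \<gamma>. \<gamma> \<in> supp t}"
    using keys_mult[of "monomial 1 \<eta>" t] by auto
  ultimately have low: "prec \<sigma> (head p)" if "\<sigma> \<in> supp (monomial 1 \<eta> * t)" for \<sigma>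
    using that assms(2) a by (fastforce simp: ordered_by_def pe head_def add.commute)
  have e: "elt F p = monomial 1 (head p) + monomial 1 \<eta> * t"
    by (simp add: pe elt_def t_def head_def right_diff_distrib mult_single)
  have "irreflp prec" using assms(2) by (simp add: ordered_by_def well_founded_order_def)
  then have "head p \<notin> supp (monomial 1 \<eta> * t)" using low by (metis irreflpD)
  then show "coeff (elt F p) (head p) = 1" by (simp add: e lookup_add in_keys_iff)
  show "prec\<^sup>=\<^sup>= \<sigma> (head p)" if "\<sigma> \<in> supp (elt F p)" for \<sigma>
    using that low keys_add[of "monomial 1 (head p)" "monomial 1 \<eta> * t"] by (auto simp: e)
qed

lemma reflclp_trans: "transp R \<Longrightarrow> R\<^sup>=\<^sup>= x y \<Longrightarrow> R\<^sup>=\<^sup>= y z \<Longrightarrow> R\<^sup>=\<^sup>= x z"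
  by (auto dest: transpD)

text \<open>
  Keeping the support within \<open>S\<close> makes the heads of the representation distinct as soon as \<open>head\<close> is
  injective on \<open>S\<close>.
\<close>
lemma red_chain_representation:
  assumes "marked_set J F" and "ordered_by prec J" and "S \<subseteq> index_pairs J"
    and "(red_step_by F S)\<^sup>*\<^sup>* g l"
  obtains c where "tau_representation J F c (g - l)" and "supp c \<subseteq> S" and "heads_bounded prec c g"
proof -
  define D where "D = {\<sigma>. \<exists>\<delta>\<in>supp g. prec\<^sup>=\<^sup>= \<sigma> \<delta>}"
  have tr: "transp prec" using assms(2) by (simp add: ordered_by_def well_founded_order_def)
  have "g - l \<in> poly_space.span (elt F ` {p \<in> S. head p \<in> D})"
  proof (intro conjunct2[OF red_chain_span[OF assms(4)]])
    show "supp g \<subseteq> D" by (auto simp: D_def)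
    fix p assume "p \<in> S" "head p \<in> D"
    then show "supp (elt F p) \<subseteq> D"
      using elt_terms_below_head(2)[OF assms(1,2)] assms(3) reflclp_trans[OF tr]
      unfolding D_def by blast
  qed
  then obtain c where "tau_representation J F c (g - l)" "supp c \<subseteq> {p \<in> S. head p \<in> D}"
    by (rule representation_of_span) (use assms(3) in auto)
  then show thesis by (intro that) (auto simp: heads_bounded_def D_def)
qed

text \<open>
  A maximal head among those of \<open>P\<close> is not a term of any other element of \<open>P\<close>, so that its
  coefficient survives in \<open>g\<close>. Reducing it first therefore removes exactly one summand. The terms
  that this step introduces lie below the removed head, which is why the bounds for the remaining
  heads carry over to \<open>g\<close>.
\<close>
lemma reduction_along_representation:
  fixes F :: "'n pp \<Rightarrow> ('n, 'a::field) mpoly"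
  assumes marked: "marked_set J F" and ord: "ordered_by prec J"
    and l: "supp l \<inter> head ` index_pairs J = {}"
    and "finite P" and "P \<subseteq> index_pairs J" and "inj_on head P" and "\<And>p. p \<in> P \<Longrightarrow> c p \<noteq> 0"
    and "g = l + (\<Sum>p\<in>P. monomial (c p) 0 * elt F p)"
  shows "(red_step J F)\<^sup>*\<^sup>* g l \<and> (\<forall>p\<in>P. \<exists>\<delta>\<in>supp g. prec\<^sup>=\<^sup>= (head p) \<delta>)"
  using assms(4-)
proof (induction P arbitrary: g rule: finite_psubset_induct)
  case (psubset P)
  have tr: "transp prec" and ir: "irreflp prec"
    using ord by (simp_all add: ordered_by_def well_founded_order_def)
  show ?case
  proof (cases "P = {}")
    case True
    then show ?thesis using psubset.prems by simp
  next
    case False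
    have as: "asymp prec" using tr ir by (metis asympI irreflpD transpD)
    obtain p where p: "p \<in> P" and pmax: "\<And>q. q \<in> P \<Longrightarrow> head q \<noteq> head p \<Longrightarrow> \<not> prec (head p) (head q)"
    proof -
      have "\<exists>m\<in>head ` P. \<forall>x\<in>head ` P. x \<noteq> m \<longrightarrow> \<not> prec m x"
        using psubset.hyps False asymp_on_subset[OF as subset_UNIV]
          transp_on_subset[OF tr subset_UNIV]
        by (intro Finite_Set.bex_max_element) auto
      then show thesis using that by blast
    qed
    have pI: "p \<in> index_pairs J" using p psubset.prems by auto
    have "coeff (elt F q) (head p) = 0" if "q \<in> P - {p}" for q
    proof (rule ccontr)
      assume "coeff (elt F q) (head p) \<noteq> 0"
      then have "prec\<^sup>=\<^sup>= (head p) (head q)"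
        using that psubset.prems(1) elt_terms_below_head(2)[OF marked ord, of q]
        by (auto simp: in_keys_iff)
      moreover have "head q \<noteq> head p" using that p psubset.prems(2) by (auto dest: inj_onD)
      ultimately show False using pmax[of q] that by auto
    qed
    then have z: "coeff (monomial (c q) 0 * elt F q) (head p) = 0" if "q \<in> P - {p}" for q
      using that subsetD[OF supp_scale_subset, of "head p" "c q" "elt F q"]
      unfolding in_keys_iff by metis
    have "coeff l (head p) = 0" using l pI by (auto simp: in_keys_iff)
    moreover have "coeff (monomial (c p) 0 * elt F p) (head p) = c p"
      using elt_terms_below_head(1)[OF marked ord pI]
      by (simp add: mult_map_scale_conv_mult[symmetric] Poly_Mapping.map.rep_eq when_def)
    ultimately have cg: "coeff g (head p) = c p"
      using psubset.hyps p z unfolding psubset.prems(4)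
      by (simp add: lookup_add lookup_sum sum.remove[of P p])
    then have pg: "head p \<in> supp g" using p psubset.prems(3) by (simp add: in_keys_iff)
    define g' where "g' = g - monomial (c p) 0 * elt F p"
    have step: "red_step J F g g'"
      unfolding red_step_by_iff g'_def using pI pg cg by auto
    have g': "g' = l + (\<Sum>q\<in>P - {p}. monomial (c q) 0 * elt F q)"
      unfolding g'_def psubset.prems(4) using psubset.hyps p by (simp add: sum.remove[of P p])
    have IH: "(red_step J F)\<^sup>*\<^sup>* g' l \<and> (\<forall>q\<in>P - {p}. \<exists>\<delta>\<in>supp g'. prec\<^sup>=\<^sup>= (head q) \<delta>)"
      using p psubset.prems by (intro psubset.IH[OF _ _ _ _ g']) (auto intro: inj_on_subset)
    have below: "\<exists>\<delta>'\<in>supp g. prec\<^sup>=\<^sup>= \<delta> \<delta>'" if "\<delta> \<in> supp g'" for \<delta>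
    proof (cases "\<delta> \<in> supp g")
      case False
      then have "\<delta> \<in> supp (elt F p)"
        using that keys_diff[of g "monomial (c p) 0 * elt F p"]
          supp_scale_subset[of "c p" "elt F p"] unfolding g'_def by blast
      then show ?thesis using elt_terms_below_head(2)[OF marked ord pI] pg by blast
    qed auto
    have "\<exists>\<delta>\<in>supp g. prec\<^sup>=\<^sup>= (head q) \<delta>" if "q \<in> P" for q
    proof (cases "q = p")
      case True
      then show ?thesis using pg by auto
    next
      case False
      then obtain \<delta> where "\<delta> \<in> supp g'" "prec\<^sup>=\<^sup>= (head q) \<delta>" using IH \<open>q \<in> P\<close> by blast
      then show ?thesis using below reflclp_trans[OF tr] by blast
    qed
    then show ?thesis using IH step by (meson converse_rtranclp_into_rtranclp)
  qed
qed

section \<open>Reduced forms and their representations\<close>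

theorem proposition6p2:
  fixes J :: "'n::finite red_struct"
    and F :: "'n pp \<Rightarrow> ('n, 'a::field) mpoly"
    and g :: "('n, 'a) mpoly"
  assumes "red_structure J"
    and "weakly_noetherian TYPE('a) J"
    and "marked_set J F"
  shows
    "(\<exists>l. reduced_form J F g l \<and> (\<exists>c. tau_representation J F c (g - l))) \<and>
     (disjoint_cones J \<longrightarrow>
       (\<exists>!l. supp l \<subseteq> nonideal_terms J \<and> g - l \<in> poly_space.span (tau_set J F)) \<and>
       (\<forall>l. supp l \<subseteq> nonideal_terms J \<and> g - l \<in> poly_space.span (tau_set J F)
          \<longrightarrow> (\<exists>!c. tau_representation J F c (g - l)))) \<and>
     (\<forall>prec. noetherian TYPE('a) J \<and> ordered_by prec J \<longrightarrow>
       (\<forall>l c. supp l \<subseteq> nonideal_terms J \<and> tau_representation J F c (g - l) \<and> distinct_heads c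
          \<longrightarrow> reduced_form J F g l \<and> heads_bounded prec c g) \<and>
       (\<forall>l. reduced_form J F g l \<longrightarrow>
          (\<exists>c. tau_representation J F c (g - l) \<and> heads_bounded prec c g)) \<and>
       (\<forall>S l. S \<subseteq> index_pairs J \<and> inj_on head S \<and>
              (red_step_by F S)\<^sup>*\<^sup>* g l \<and> supp l \<subseteq> nonideal_terms J \<longrightarrow>
          (\<exists>c. tau_representation J F c (g - l) \<and> distinct_heads c \<and> heads_bounded prec c g)) \<and>
       (\<forall>\<delta> l. g = monomial 1 \<delta> \<and> reduced_form J F g l \<longrightarrow>
          (\<exists>c. lower_representation prec \<delta> J F c (g - l))))"
proof -
  let ?sp = "poly_space.span"
  obtain J' where J': "substructure J' J" "noetherian TYPE('a) J'"
    using assms(2) by (auto simp: weakly_noetherian_def)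
  have terminates: "\<nexists>G :: nat \<Rightarrow> ('n, 'a) mpoly. \<forall>i. red_step J' F (G i) (G (Suc i))"
    using J' marked_set_substructure[OF J'(1) assms(3)] unfolding noetherian_def by blast
  have N: "supp l \<subseteq> nonideal_terms J \<longleftrightarrow> supp l \<inter> head ` index_pairs J = {}"
    for l :: "('n, 'a) mpoly"
    using heads_eq_gen_ideal[OF assms(1)] by (auto simp: nonideal_terms_def)

  have chain: "g - l \<in> ?sp (tau_set J F)" if "(red_step J F)\<^sup>*\<^sup>* g l" for l
    using red_chain_span[OF that, of UNIV] by (simp add: tau_set_def)
  have ex: "\<exists>l. reduced_form J F g l"
  proof -
    obtain l where l: "(red_step J' F)\<^sup>*\<^sup>* g l" "supp l \<inter> head ` index_pairs J' = {}"
      using terminating_reduction_avoids_heads[OF terminates] by blast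
    have "head ` index_pairs J' = head ` index_pairs J"
      using J'(1) assms(1) heads_eq_gen_ideal gen_ideal_substructure by (metis substructure_def)
    then show ?thesis
      using l red_chain_mono[OF l(1) index_pairs_substructure[OF J'(1)]] N
      by (auto simp: reduced_form_def)
  qed
  have rep: "\<exists>c. tau_representation J F c h" if "h \<in> ?sp (tau_set J F)" for h
    using representation_of_span[of h F "index_pairs J" J] that by (auto simp: tau_set_def)

  have i: "\<exists>l. reduced_form J F g l \<and> (\<exists>c. tau_representation J F c (g - l))"
    using ex rep chain by (meson reduced_form_def)

  have ii: "(\<exists>!l. supp l \<subseteq> nonideal_terms J \<and> g - l \<in> ?sp (tau_set J F)) \<and>
       (\<forall>l. supp l \<subseteq> nonideal_terms J \<and> g - l \<in> ?sp (tau_set J F)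
          \<longrightarrow> (\<exists>!c. tau_representation J F c (g - l)))" if dc: "disjoint_cones J"
  proof -
    have inj: "inj_on head (index_pairs J)" by (rule inj_on_head_if_disjoint_cones[OF dc])
    have terminates': "\<nexists>G :: nat \<Rightarrow> ('n, 'a) mpoly. \<forall>i. red_step J F (G i) (G (Suc i))"
      using terminates index_pairs_substructure_disjoint_cones[OF assms(1) J'(1) dc] by simp
    have uniq: "l = l'"
      if l: "supp l \<subseteq> nonideal_terms J" "g - l \<in> ?sp (tau_set J F)"
        and l': "supp l' \<subseteq> nonideal_terms J" "g - l' \<in> ?sp (tau_set J F)" for l l'
    proof -
      obtain c d where c: "tau_representation J F c (g - l)"
        and d: "tau_representation J F d (g - l')"
        using rep l(2) l'(2) by blast
      have "supp ((g - l) - (g - l')) \<subseteq> supp l' \<union> supp l"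
        using keys_diff[of l' l] by simp
      then have "c = d"
        using l(1) l'(1) N by (intro representation_unique[OF inj terminates' c d]) blast
      then have "g - l = g - l'" using c d by (simp add: tau_representation_def)
      then show "l = l'" by (metis diff_diff_eq2 add_diff_cancel_left' diff_add_cancel)
    qed
    have "c = d" if "tau_representation J F c (g - l)" "tau_representation J F d (g - l)" for l c d
      using representation_unique[OF inj terminates' that] by simp
    then show ?thesis
      using ex chain uniq rep unfolding reduced_form_def by meson
  qed

  have iii_rep_to_red: "reduced_form J F g l \<and> heads_bounded prec c g"
    if ord: "ordered_by prec J" and l: "supp l \<subseteq> nonideal_terms J"
      and c: "tau_representation J F c (g - l)" and "distinct_heads c" for prec l c
  proof -
    have "g = l + (\<Sum>p\<in>supp c. monomial (coeff c p) 0 * elt F p)"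
      using c unfolding tau_representation_def by (simp add: algebra_simps)
    then have "(red_step J F)\<^sup>*\<^sup>* g l \<and> (\<forall>p\<in>supp c. \<exists>\<delta>\<in>supp g. prec\<^sup>=\<^sup>= (head p) \<delta>)"
      using that N
      by (intro reduction_along_representation[OF assms(3) ord, where c = "coeff c"])
         (auto simp: tau_representation_def distinct_heads_def in_keys_iff)
    then show ?thesis using l by (simp add: reduced_form_def heads_bounded_def)
  qed
  have iii_red_to_rep: "\<exists>c. tau_representation J F c (g - l) \<and> heads_bounded prec c g"
    if "ordered_by prec J" "reduced_form J F g l" for prec l
    using red_chain_representation[OF assms(3) that(1) subset_refl] that(2)
    unfolding reduced_form_def by metis
  have iii_distinct:
    "\<exists>c. tau_representation J F c (g - l) \<and> distinct_heads c \<and> heads_bounded prec c g"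
    if "ordered_by prec J" "S \<subseteq> index_pairs J" "inj_on head S" "(red_step_by F S)\<^sup>*\<^sup>* g l"
    for prec S l
    using red_chain_representation[OF assms(3) that(1,2,4)] that(3)
    unfolding distinct_heads_def by (metis inj_on_subset)
  have iv: "\<exists>c. lower_representation prec \<delta> J F c (g - l)"
    if "ordered_by prec J" "g = monomial 1 \<delta>" "reduced_form J F g l" for prec \<delta> l
    using iii_red_to_rep[OF that(1,3)] that(2)
    by (auto simp: lower_representation_def heads_bounded_def)

  show ?thesis
    by (intro conjI allI impI)
       ((rule i | erule ii[THEN conjunct1] | erule ii[THEN conjunct2, rule_format], assumption
         | elim conjE,
           (rule iii_rep_to_red[THEN conjunct1] iii_rep_to_red[THEN conjunct2]
             iii_red_to_rep iii_distinct iv; assumption))+)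
qed

end
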